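(* Let $a_0,\dots,a_n\in\mathbb R$, with at least one $a_j\neq 0$ for $1\le j\le n$, let $P\big(\frac{d}{dt}\big)=a_n\frac{d^n}{dt^n}+\dots+a_1\frac{d}{dt}+a_0I$, and let $p(t)=a_nt^n+\dots+a_1t+a_0$ be its characteristic polynomial. Let $R=R(t)$ be a nonzero polynomial with real coefficients, let $\gamma\in\mathbb C$ and $\delta\in\mathbb R$, with $\delta=0$ if $\gamma\in\mathbb R$. Then the equation $$P\Big(\frac{d}{dt}\Big)x=R(t)e^{\gamma t+i\delta}$$ has a particular solution of the form $Q(t)e^{\gamma t+i\delta}$ with $Q$ a polynomial (with complex coefficients); namely, there exist polynomials $Q$ satisfying $$\frac{p^{(n)}(\gamma)}{n!}Q^{(n)}+\dots+\frac{p'(\gamma)}{1!}Q'+\frac{p(\gamma)}{0!}Q=R, \qquad ( * )$$ and for an arbitrary polynomial $Q$ satisfying $( * )$ the function $Q(t)e^{\gamma t+i\delta}$ is a solution of the equation. Moreover: (a) If $\gamma\in\mathbb R$, then the polynomial $Q$ satisfying $( * )$ can be taken with real coefficients, so that the solution $x(t)=Q(t)e^{\gamma t}$ is real. (b) If $\gamma\notin\mathbb R$, then $z(t)=Q(t)e^{\gamma t+i\delta}$ is a complex solution; writing $\gamma=\alpha+\beta i$ with $\alpha,\beta\in\mathbb R$, the functions $x(t)=\mathrm{Re}[z(t)]$ and $y(t)=\mathrm{Im}[z(t)]$ satisfy $$P\Big(\frac{d}{dt}\Big)x=R(t)e^{\alpha t}\cos(\beta t+\delta),\qquad P\Big(\frac{d}{dt}\Big)y=R(t)e^{\alpha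 t}\sin(\beta t+\delta).$$ (c) If $p(\gamma)\neq 0$, then $\deg Q=\deg R$. (d) If $\gamma$ is a root of $p$ of multiplicity $k$, then the polynomial $Q$ satisfying $( * )$ can be chosen of the form $Q(t)=t^kQ_1(t)$, where $Q_1$ is a polynomial with $\deg Q_1=\deg R$.
   Context: The variable $t$ is real; $I$ is the identity operator on $C^\infty(\mathbb R;\mathbb C)$, the space of infinitely differentiable functions $\mathbb R\to\mathbb C$, and $f^{(k)}$ denotes the $k$-th derivative of $f$. The operator $P(\frac{d}{dt})$ acts on $C^\infty(\mathbb R;\mathbb C)$. *)

theory Defs
  imports "HOL-Analysis.Analysis" "HOL-Computational_Algebra.Computational_Algebra"
begin

definition nth_derivative :: "nat \<Rightarrow> (real \<Rightarrow> complex) \<Rightarrow> real \<Rightarrow> complex" where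
  "nth_derivative k = (\<lambda>f t. vector_derivative f (at t)) ^^ k"

definition C_infinity :: "(real \<Rightarrow> complex) set" where
  "C_infinity = {f. \<forall>k t. nth_derivative k f differentiable at t}"

text \<open>The operator \<open>P(d/dt)\<close> is meant for arguments in \<^const>\<open>C_infinity\<close>; on other functions its
  value depends on unspecified derivatives.\<close>

definition diff_op :: "nat \<Rightarrow> (nat \<Rightarrow> real) \<Rightarrow> (real \<Rightarrow> complex) \<Rightarrow> real \<Rightarrow> complex" where
  "diff_op n a f = (\<lambda>t. \<Sum>j\<le>n. complex_of_real (a j) * nth_derivative j f t)"

definition is_solution :: "nat \<Rightarrow> (nat \<Rightarrow> real) \<Rightarrow> (real \<Rightarrow> complex) \<Rightarrow> (real \<Rightarrow> complex) \<Rightarrow> bool" where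
  "is_solution n a g x \<longleftrightarrow> x \<in> C_infinity \<and> diff_op n a x = g"

definition characteristic_poly :: "nat \<Rightarrow> (nat \<Rightarrow> real) \<Rightarrow> real poly" where
  "characteristic_poly n a = (\<Sum>j\<le>n. monom (a j) j)"

abbreviation complex_poly :: "real poly \<Rightarrow> complex poly" where
  "complex_poly \<equiv> map_poly complex_of_real"

text \<open>Equation for \<open>Q\<close> obtained by substituting \<open>Q(t) exp (\<gamma>t + i\<delta>)\<close> into the differential equation with
  right-hand side \<open>R(t) exp (\<gamma>t + i\<delta>)\<close> and cancelling the exponential; the coefficients are those of the
  Taylor expansion of the characteristic polynomial at \<open>\<gamma>\<close>.\<close>

definition reduced_eq ::
    "nat \<Rightarrow> (nat \<Rightarrow> real) \<Rightarrow> complex \<Rightarrow> real poly \<Rightarrow> complex poly \<Rightarrow> bool" where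
  "reduced_eq n a \<gamma> R Q \<longleftrightarrow>
     (\<Sum>k\<le>n. smult (poly (complex_poly ((pderiv ^^ k) (characteristic_poly n a))) \<gamma> / fact k)
                   ((pderiv ^^ k) Q)) = complex_poly R"

definition quasi_poly :: "complex \<Rightarrow> real \<Rightarrow> complex poly \<Rightarrow> real \<Rightarrow> complex" where
  "quasi_poly \<gamma> \<delta> Q = (\<lambda>t. poly Q (of_real t) * exp (\<gamma> * of_real t + \<i> * of_real \<delta>))"

end

theory Submission
  imports Defs
begin

text \<open>
  Write \<open>c\<^sub>k = p\<^sup>(\<^sup>k\<^sup>)(\<gamma>) / k!\<close>, so that \<open>p(\<gamma> + s)\<close> is the sum of the \<open>c\<^sub>k s\<^sup>k\<close>.
  Differentiating \<open>Q(t) exp(\<gamma>t + i\<delta>)\<close> replaces \<open>Q\<close> by \<open>(D + \<gamma>)Q\<close>, where \<open>D\<close> is the derivative of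
  polynomials. Hence \<open>P(d/dt)\<close> replaces \<open>Q\<close> by \<open>p(D + \<gamma>)Q\<close>, which is the sum of the
  \<open>c\<^sub>k Q\<^sup>(\<^sup>k\<^sup>)\<close> (\<open>diff_op_quasi_poly\<close>), and every solution of the reduced equation solves the
  differential equation.

  It remains to solve an equation between polynomials. Let \<open>m\<close> be the order of \<open>\<gamma>\<close> as a root of
  \<open>p\<close>; then \<open>c\<^sub>m\<close> is the first nonzero coefficient (\<open>taylor_coeff_order\<close>). On \<open>t\<^sup>m Q\<^sub>1\<close> the operator
  maps each power of \<open>t\<close> in \<open>Q\<^sub>1\<close> to a nonzero multiple of the same power plus lower ones. A map of
  this triangular form preserves degrees (\<open>degree_const_coeff_op_monom_mult\<close>) and is onto
  (\<open>const_coeff_op_monom_mult_surj\<close>), which yields solvability, the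
  factor \<open>t\<^sup>k\<close> at a root of multiplicity \<open>k\<close>, and, for \<open>m = 0\<close>, the equality of degrees. The argument
  works over every field of characteristic zero; over the reals it gives a real \<open>Q\<close> for real \<open>\<gamma>\<close>.

  Finally \<open>P(d/dt)\<close> has real coefficients and so commutes with real and imaginary parts
  (\<open>is_solution_bounded_linear\<close>).
\<close>

section \<open>Constant-coefficient operators on polynomials\<close>

definition const_coeff_op :: "nat \<Rightarrow> (nat \<Rightarrow> 'a) \<Rightarrow> 'a poly \<Rightarrow> 'a::field_char_0 poly" where
  "const_coeff_op n c Q = (\<Sum>k\<le>n. smult (c k) ((pderiv ^^ k) Q))"

lemma coeff_const_coeff_op:
  "coeff (const_coeff_op n c Q) i
     = (\<Sum>k\<le>n. c k * (pochhammer (of_nat (Suc i)) k * coeff Q (i + k)))"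
  by (simp add: const_coeff_op_def coeff_sum coeff_higher_pderiv)

lemma const_coeff_op_add: "const_coeff_op n c (P + Q) = const_coeff_op n c P + const_coeff_op n c Q"
  by (simp add: const_coeff_op_def higher_pderiv_add smult_add_right sum.distrib)

text \<open>
  If the derivatives of order below \<open>m\<close> are absent, then applying the operator to \<open>t\<^sup>m Q\<close> shifts the
  powers back: the result is triangular in the coefficients of \<open>Q\<close>, and in characteristic
  zero the diagonal entries are nonzero as soon as \<open>c m\<close> is.
\<close>

lemma coeff_const_coeff_op_monom_mult:
  assumes "m \<le> n" and "\<forall>k<m. c k = 0"
  shows "coeff (const_coeff_op n c (monom 1 m * Q)) i
    = c m * pochhammer (of_nat (Suc i)) m * coeff Q i
      + (\<Sum>k\<in>{m<..n}. c k * pochhammer (of_nat (Suc i)) k * coeff Q (i + k - m))"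
proof -
  have "coeff (const_coeff_op n c (monom 1 m * Q)) i
      = (\<Sum>k\<in>{m..n}. c k * pochhammer (of_nat (Suc i)) k * coeff Q (i + k - m))"
    unfolding coeff_const_coeff_op
    by (rule sum.mono_neutral_cong_right) (auto simp: assms coeff_monom_mult)
  also have "{m..n} = insert m {m<..n}"
    using assms(1) by auto
  finally show ?thesis
    by simp
qed

lemma triangular_diagonal_nonzero:
  "c \<noteq> 0 \<Longrightarrow> c * pochhammer (of_nat (Suc i)) m \<noteq> (0::'a::field_char_0)"
  by (metis mult_eq_0_iff of_nat_eq_0_iff pochhammer_of_nat pochhammer_pos neq0_conv zero_less_Suc)

lemma degree_const_coeff_op_monom_mult:
  assumes "m \<le> n" and "\<forall>k<m. c k = 0" and "c m \<noteq> 0"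
  shows "degree (const_coeff_op n c (monom 1 m * Q)) = degree Q"
proof (cases "Q = 0")
  case True
  then show ?thesis
    by (simp add: const_coeff_op_def)
next
  case False
  let ?T = "const_coeff_op n c (monom 1 m * Q)"
  have "(\<Sum>k\<in>{m<..n}. c k * pochhammer (of_nat (Suc (degree Q))) k * coeff Q (degree Q + k - m)) = 0"
    by (rule sum.neutral) (auto simp: coeff_eq_0)
  then have "coeff ?T (degree Q) = c m * pochhammer (of_nat (Suc (degree Q))) m * lead_coeff Q"
    unfolding coeff_const_coeff_op_monom_mult[OF assms(1,2)] by simp
  then have "coeff ?T (degree Q) \<noteq> 0"
    using False triangular_diagonal_nonzero[OF assms(3)] by (metis leading_coeff_0_iff mult_eq_0_iff)
  moreover have "coeff ?T i = 0" if "degree Q < i" for i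
  proof -
    have "(\<Sum>k\<in>{m<..n}. c k * pochhammer (of_nat (Suc i)) k * coeff Q (i + k - m)) = 0"
      by (rule sum.neutral) (use that in \<open>auto simp: coeff_eq_0\<close>)
    then show ?thesis
      unfolding coeff_const_coeff_op_monom_mult[OF assms(1,2)] using that by (simp add: coeff_eq_0)
  qed
  ultimately show ?thesis
    by (metis degree_le le_antisym le_degree)
qed

text \<open>Back substitution in the triangular system, from the highest coefficient downwards.\<close>

lemma const_coeff_op_monom_mult_surj:
  assumes "m \<le> n" and "\<forall>k<m. c k = 0" and "c m \<noteq> 0"
  obtains Q where "const_coeff_op n c (monom 1 m * Q) = R" and "degree Q = degree R"
proof -
  have "\<exists>Q. const_coeff_op n c (monom 1 m * Q) = R" if "\<And>i. d \<le> i \<Longrightarrow> coeff R i = 0" for d R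
    using that
  proof (induction d arbitrary: R)
    case 0
    then have "R = 0"
      by (intro poly_eqI) simp
    then show ?case
      by (intro exI[of _ 0]) (simp add: const_coeff_op_def)
  next
    case (Suc d)
    define e where "e = c m * pochhammer (of_nat (Suc d)) m"
    define M where "M = monom (coeff R d / e) d"
    have e: "e \<noteq> 0"
      unfolding e_def by (rule triangular_diagonal_nonzero[OF assms(3)])
    \<comment> \<open>Subtracting the image of \<open>M\<close> removes the term of degree \<open>d\<close> and, by triangularity, creates
      none of higher degree.\<close>
    have "coeff (R - const_coeff_op n c (monom 1 m * M)) i = 0" if "d \<le> i" for i
    proof (cases "i = d")
      case True
      have "(\<Sum>k\<in>{m<..n}. c k * pochhammer (of_nat (Suc d)) k * coeff M (d + k - m)) = 0"
        by (rule sum.neutral) (auto simp: M_def)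
      then have "coeff (const_coeff_op n c (monom 1 m * M)) d = e * coeff M d"
        unfolding coeff_const_coeff_op_monom_mult[OF assms(1,2)] e_def by simp
      then show ?thesis
        using True e by (simp add: M_def)
    next
      case False
      have "(\<Sum>k\<in>{m<..n}. c k * pochhammer (of_nat (Suc i)) k * coeff M (i + k - m)) = 0"
        by (rule sum.neutral) (use that in \<open>auto simp: M_def\<close>)
      moreover have "coeff M i = 0"
        using False by (simp add: M_def)
      ultimately have "coeff (const_coeff_op n c (monom 1 m * M)) i = 0"
        unfolding coeff_const_coeff_op_monom_mult[OF assms(1,2)] by simp
      then show ?thesis
        using False that Suc.prems by simp
    qed
    then obtain Q where "const_coeff_op n c (monom 1 m * Q) = R - const_coeff_op n c (monom 1 m * M)"
      using Suc.IH by blast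
    then have "const_coeff_op n c (monom 1 m * (Q + M)) = R"
      by (simp add: distrib_left const_coeff_op_add)
    then show ?case
      by blast
  qed
  from this[of "Suc (degree R)" R] obtain Q where "const_coeff_op n c (monom 1 m * Q) = R"
    by (auto simp: coeff_eq_0)
  then show thesis
    using that degree_const_coeff_op_monom_mult[OF assms] by metis
qed

section \<open>Taylor coefficients of the characteristic polynomial\<close>

definition taylor_coeff :: "'a::field_char_0 poly \<Rightarrow> 'a \<Rightarrow> nat \<Rightarrow> 'a" where
  "taylor_coeff p x k = poly ((pderiv ^^ k) p) x / fact k"

lemma taylor_coeff_sum: "taylor_coeff (\<Sum>j\<in>A. f j) x k = (\<Sum>j\<in>A. taylor_coeff (f j) x k)"
  by (simp add: taylor_coeff_def higher_pderiv_sum poly_sum sum_divide_distrib)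

lemma taylor_coeff_monom:
  "taylor_coeff (monom c j) x k = c * (of_nat (j choose k) * x ^ (j - k))"
proof -
  have "(pderiv ^^ k) (monom c j) = monom (of_nat (fact k * (j choose k)) * c) (j - k)"
  proof (induction k)
    case (Suc k)
    have "(j - k) * (fact k * (j choose k)) = fact (Suc k) * (j choose Suc k)"
    proof -
      have "Suc k * (j choose Suc k) = (j - k) * (j choose k)"
        by (metis binomial_absorb_comp binomial_absorption mult.commute)
      then show ?thesis
        by (simp only: fact_Suc of_nat_id mult_ac)
    qed
    then have "of_nat (j - k) * (of_nat (fact k * (j choose k)) * c)
        = of_nat (fact (Suc k) * (j choose Suc k)) * c"
      by (metis mult.assoc of_nat_mult)
    then show ?case
      using Suc.IH by (simp only: funpow.simps o_apply pderiv_monom) simp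
  qed simp
  then show ?thesis
    by (simp add: taylor_coeff_def poly_monom)
qed

text \<open>In characteristic zero differentiation lowers the order of a root by one, so the order is the index of the first
  nonzero Taylor coefficient.\<close>

lemma taylor_coeff_order:
  assumes "p \<noteq> 0"
  shows "taylor_coeff p x (order x p) \<noteq> 0"
    and "k < order x p \<Longrightarrow> taylor_coeff p x k = 0"
proof -
  have "poly ((pderiv ^^ m) p) x \<noteq> 0 \<and> (\<forall>k<m. poly ((pderiv ^^ k) p) x = 0)"
    if "p \<noteq> 0" and "order x p = m" for p :: "'a poly" and m
    using that
  proof (induction m arbitrary: p)
    case 0
    then show ?case
      by (simp add: order_root)
  next
    case (Suc m)
    have root: "poly p x = 0"
      using Suc.prems by (simp add: order_root)
    have "pderiv p \<noteq> 0"
    proof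
      assume "pderiv p = 0"
      then have "degree p = 0"
        by (simp add: pderiv_eq_0_iff)
      then show False
        using order_degree[OF Suc.prems(1), of x] Suc.prems(2) by simp
    qed
    moreover have "order x (pderiv p) = m"
      using order_pderiv[OF Suc.prems(1) root] Suc.prems(2) by simp
    ultimately have "poly ((pderiv ^^ m) (pderiv p)) x \<noteq> 0"
      and "\<forall>k<m. poly ((pderiv ^^ k) (pderiv p)) x = 0"
      using Suc.IH by blast+
    then show ?case
      using root by (auto simp: funpow_Suc_right less_Suc_eq_0_disj simp del: funpow.simps(2))
  qed
  from this[OF assms refl]
  show "taylor_coeff p x (order x p) \<noteq> 0" and "k < order x p \<Longrightarrow> taylor_coeff p x k = 0"
    by (simp_all add: taylor_coeff_def)
qed

lemma degree_characteristic_poly: "degree (characteristic_poly n a) \<le> n"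
  unfolding characteristic_poly_def
  by (rule degree_sum_le) (auto intro: order_trans[OF degree_monom_le])

lemma coeff_characteristic_poly: "j \<le> n \<Longrightarrow> coeff (characteristic_poly n a) j = a j"
  by (simp add: characteristic_poly_def coeff_sum)

lemma taylor_coeff_characteristic_poly_order:
  assumes "characteristic_poly n a \<noteq> 0"
  defines "p \<equiv> complex_poly (characteristic_poly n a)"
  shows "order \<gamma> p \<le> n"
    and "\<forall>k<order \<gamma> p. taylor_coeff p \<gamma> k = 0"
    and "taylor_coeff p \<gamma> (order \<gamma> p) \<noteq> 0"
proof -
  have "p \<noteq> 0"
    using assms(1) by (simp add: p_def map_poly_eq_0_iff)
  then show "\<forall>k<order \<gamma> p. taylor_coeff p \<gamma> k = 0"
    and "taylor_coeff p \<gamma> (order \<gamma> p) \<noteq> 0"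
    by (simp_all add: taylor_coeff_order)
  have "degree p \<le> n"
    by (simp add: p_def degree_map_poly degree_characteristic_poly)
  then show "order \<gamma> p \<le> n"
    using order_degree[OF \<open>p \<noteq> 0\<close>, of \<gamma>] by simp
qed

lemma pochhammer_of_real: "pochhammer (of_real x) k = of_real (pochhammer x k)"
  by (simp add: pochhammer_prod)

lemma complex_poly_higher_pderiv:
  "complex_poly ((pderiv ^^ k) p) = (pderiv ^^ k) (complex_poly p)"
  by (rule poly_eqI) (simp add: coeff_map_poly coeff_higher_pderiv flip: pochhammer_of_real)

lemma poly_complex_poly_of_real: "poly (complex_poly p) (of_real x) = of_real (poly p x)"
  by (induction p) (simp_all add: map_poly_pCons)

lemma complex_poly_const_coeff_op:
  "complex_poly (const_coeff_op n c Q) = const_coeff_op n (\<lambda>k. of_real (c k)) (complex_poly Q)"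
  by (rule poly_eqI) (simp add: coeff_map_poly coeff_const_coeff_op flip: pochhammer_of_real)

lemma reduced_eq_iff:
  "reduced_eq n a \<gamma> R Q \<longleftrightarrow>
     const_coeff_op n (taylor_coeff (complex_poly (characteristic_poly n a)) \<gamma>) Q = complex_poly R"
  by (simp add: reduced_eq_def const_coeff_op_def taylor_coeff_def complex_poly_higher_pderiv)

lemma taylor_coeff_characteristic_poly:
  "taylor_coeff (complex_poly (characteristic_poly n a)) \<gamma> k
     = (\<Sum>j\<le>n. of_real (a j) * (of_nat (j choose k) * \<gamma> ^ (j - k)))"
proof -
  have "complex_poly (characteristic_poly n a) = (\<Sum>j\<le>n. monom (of_real (a j)) j)"
    by (rule poly_eqI) (simp add: characteristic_poly_def coeff_map_poly coeff_sum if_distrib cong: if_cong)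
  then show ?thesis
    by (simp add: taylor_coeff_sum taylor_coeff_monom)
qed

text \<open>For real \<open>\<gamma>\<close> the Taylor coefficients are real, so the triangular system can be solved
  over the reals.\<close>

lemma reduced_eq_real_solution:
  assumes "characteristic_poly n a \<noteq> 0"
  obtains Q :: "real poly" where "reduced_eq n a (of_real g) R (complex_poly Q)"
proof -
  let ?p = "complex_poly (characteristic_poly n a)"
  define c where "c k = taylor_coeff (characteristic_poly n a) g k" for k
  have c: "taylor_coeff ?p (of_real g) k = of_real (c k)" for k
    by (simp add: c_def taylor_coeff_def poly_complex_poly_of_real flip: complex_poly_higher_pderiv)
  note ord = taylor_coeff_characteristic_poly_order[OF assms, where \<gamma> = "of_real g"]
  obtain Q where "const_coeff_op n c (monom 1 (order (of_real g) ?p) * Q) = R"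
  proof (rule const_coeff_op_monom_mult_surj[OF ord(1), of c R])
    show "\<forall>k<order (of_real g) ?p. c k = 0"
      using ord(2) c by simp
    show "c (order (of_real g) ?p) \<noteq> 0"
      using ord(3) c by simp
  qed
  moreover have "taylor_coeff ?p (of_real g) = (\<lambda>k. of_real (c k))"
    using c by blast
  ultimately show thesis
    using that by (metis reduced_eq_iff complex_poly_const_coeff_op)
qed

section \<open>Differentiating quasi-polynomials\<close>

lemma smult_sum_right: "smult c (\<Sum>i\<in>A. f i) = (\<Sum>i\<in>A. smult c (f i))"
  by (induction A rule: infinite_finite_induct) (simp_all add: smult_add_right)

definition shifted_pderiv :: "'a \<Rightarrow> 'a poly \<Rightarrow> 'a::field_char_0 poly" where
  "shifted_pderiv \<gamma> Q = pderiv Q + smult \<gamma> Q"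

lemma quasi_poly_has_vector_derivative:
  "(quasi_poly \<gamma> \<delta> Q has_vector_derivative quasi_poly \<gamma> \<delta> (shifted_pderiv \<gamma> Q) t) (at t)"
proof -
  have "((\<lambda>z. poly Q z * exp (\<gamma> * z + \<i> * of_real \<delta>)) has_field_derivative
      poly (shifted_pderiv \<gamma> Q) z * exp (\<gamma> * z + \<i> * of_real \<delta>)) (at z)" for z
    by (auto intro!: derivative_eq_intros simp: shifted_pderiv_def algebra_simps)
  then show ?thesis
    unfolding quasi_poly_def by (rule has_vector_derivative_real_field)
qed

lemma nth_derivative_Suc:
  "nth_derivative (Suc k) f = (\<lambda>t. vector_derivative (nth_derivative k f) (at t))"
  by (simp add: nth_derivative_def)

lemma nth_derivative_quasi_poly:
  "nth_derivative k (quasi_poly \<gamma> \<delta> Q) = quasi_poly \<gamma> \<delta> ((shifted_pderiv \<gamma> ^^ k) Q)"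
proof (induction k)
  case 0
  show ?case
    by (simp add: nth_derivative_def)
next
  case (Suc k)
  then show ?case
    by (simp add: nth_derivative_Suc vector_derivative_at[OF quasi_poly_has_vector_derivative])
qed

lemma quasi_poly_in_C_infinity: "quasi_poly \<gamma> \<delta> Q \<in> C_infinity"
  by (auto simp: C_infinity_def nth_derivative_quasi_poly
      intro: differentiableI_vector quasi_poly_has_vector_derivative)

text \<open>The binomial theorem for the commuting operators \<open>d/dt\<close> and \<open>\<gamma>\<close>. The summation bound is
  independent of \<open>j\<close> so that the outer sum over \<open>j\<close> can be interchanged with this one; the
  surplus binomial coefficients vanish.\<close>

lemma shifted_pderiv_power:
  "j \<le> n \<Longrightarrow> (shifted_pderiv \<gamma> ^^ j) Q
     = const_coeff_op n (\<lambda>k. of_nat (j choose k) * \<gamma> ^ (j - k)) Q"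
proof (induction j)
  case 0
  have "const_coeff_op n (\<lambda>k. of_nat (0 choose k) * \<gamma> ^ (0 - k)) Q
      = (\<Sum>k\<in>{0}. smult (of_nat (0 choose k) * \<gamma> ^ (0 - k)) ((pderiv ^^ k) Q))"
    unfolding const_coeff_op_def by (rule sum.mono_neutral_right) auto
  then show ?case
    by simp
next
  case (Suc j)
  define b where "b j k = of_nat (j choose k) * \<gamma> ^ (j - k)" for j k
  have pascal: "b (Suc j) k = \<gamma> * b j k + (if k = 0 then 0 else b j (k - 1))" for k
  proof (cases k)
    case (Suc l)
    show ?thesis
    proof (cases "l < j")
      case True
      then have "j - l = Suc (j - Suc l)"
        by simp
      then show ?thesis
        using Suc by (simp add: b_def algebra_simps)
    next
      case False
      then show ?thesis
        using Suc by (simp add: b_def)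
    qed
  qed (simp add: b_def)
  \<comment> \<open>Comparing coefficients, the derivative contributes the shifted summand of Pascal's rule
    and the multiplication by \<open>\<gamma>\<close> the unshifted one.\<close>
  show ?case
    unfolding b_def[symmetric]
  proof (rule poly_eqI)
    fix i
    let ?u = "\<lambda>k. pochhammer (of_nat (Suc i)) k * coeff Q (i + k)"
    have top: "b j n = 0"
      using Suc.prems by (simp add: b_def)
    have "coeff ((shifted_pderiv \<gamma> ^^ Suc j) Q) i
        = of_nat (Suc i) * coeff (const_coeff_op n (b j) Q) (Suc i)
          + \<gamma> * coeff (const_coeff_op n (b j) Q) i"
    proof -
      have "(shifted_pderiv \<gamma> ^^ j) Q = const_coeff_op n (b j) Q"
        using Suc by (simp add: b_def[abs_def])
      then show ?thesis
        by (simp only: funpow.simps o_apply) (simp add: shifted_pderiv_def coeff_pderiv)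
    qed
    also have "of_nat (Suc i) * coeff (const_coeff_op n (b j) Q) (Suc i)
        = (\<Sum>k\<le>n. b j k * ?u (Suc k))"
      unfolding coeff_const_coeff_op sum_distrib_left
      by (rule sum.cong) (simp_all add: pochhammer_rec algebra_simps)
    also have "\<dots> = (\<Sum>k<n. b j k * ?u (Suc k))"
      using top by (simp add: lessThan_Suc_atMost[symmetric])
    also have "\<dots> = (\<Sum>k\<le>n. (if k = 0 then 0 else b j (k - 1)) * ?u k)"
      by (subst sum.atMost_shift) simp
    finally show "coeff ((shifted_pderiv \<gamma> ^^ Suc j) Q) i = coeff (const_coeff_op n (b (Suc j)) Q) i"
      unfolding coeff_const_coeff_op
      by (simp only: pascal distrib_right sum.distrib sum_distrib_left mult.assoc add.commute)
  qed
qed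

text \<open>
  Expand every \<open>(D + \<gamma>)\<^sup>j\<close> by the binomial theorem and interchange the sums: the \<open>k\<close>-th derivative
  of \<open>Q\<close> is then multiplied by the sum of \<open>a\<^sub>j (j choose k) \<gamma>\<^sup>j\<^sup>-\<^sup>k\<close> over \<open>j\<close>, which is the Taylor
  coefficient of the characteristic polynomial at \<open>\<gamma>\<close>.
\<close>

lemma diff_op_quasi_poly:
  "diff_op n a (quasi_poly \<gamma> \<delta> Q) = quasi_poly \<gamma> \<delta>
     (const_coeff_op n (taylor_coeff (complex_poly (characteristic_poly n a)) \<gamma>) Q)"
proof -
  have "diff_op n a (quasi_poly \<gamma> \<delta> Q)
      = quasi_poly \<gamma> \<delta> (\<Sum>j\<le>n. smult (of_real (a j)) ((shifted_pderiv \<gamma> ^^ j) Q))"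
    unfolding diff_op_def nth_derivative_quasi_poly
    by (simp add: quasi_poly_def poly_sum sum_distrib_right mult.assoc)
  also have "(\<Sum>j\<le>n. smult (of_real (a j)) ((shifted_pderiv \<gamma> ^^ j) Q))
      = (\<Sum>j\<le>n. \<Sum>k\<le>n. smult (of_real (a j) * (of_nat (j choose k) * \<gamma> ^ (j - k))) ((pderiv ^^ k) Q))"
    by (rule sum.cong) (simp_all add: shifted_pderiv_power[of _ n] const_coeff_op_def smult_sum_right)
  also have "\<dots> = const_coeff_op n (taylor_coeff (complex_poly (characteristic_poly n a)) \<gamma>) Q"
    unfolding const_coeff_op_def taylor_coeff_characteristic_poly smult_sum by (rule sum.swap)
  finally show ?thesis .
qed

lemma is_solution_quasi_poly:
  assumes "reduced_eq n a \<gamma> R Q"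
  shows "is_solution n a (quasi_poly \<gamma> \<delta> (complex_poly R)) (quasi_poly \<gamma> \<delta> Q)"
  using assms by (simp add: is_solution_def quasi_poly_in_C_infinity diff_op_quasi_poly reduced_eq_iff)

section \<open>Real and imaginary parts\<close>

text \<open>Real and imaginary part are treated together: both are bounded real-linear maps, they commute
  with differentiation, and, the \<open>a\<^sub>j\<close> being real, with the whole operator.\<close>

lemma is_solution_bounded_linear:
  assumes "is_solution n a g z" and "bounded_linear h"
  shows "is_solution n a (\<lambda>t. h (g t)) (\<lambda>t. h (z t))"
proof -
  interpret bounded_linear h
    by fact
  have smooth: "nth_derivative k z differentiable at t" for k t
    using assms(1) by (simp add: is_solution_def C_infinity_def)
  have deriv: "((\<lambda>t. h (nth_derivative k z t)) has_vector_derivative h (nth_derivative (Suc k) z t)) (at t)"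
    for k t
    unfolding nth_derivative_Suc
    by (rule has_vector_derivative) (metis smooth vector_derivative_works)
  have nth: "nth_derivative k (\<lambda>t. h (z t)) = (\<lambda>t. h (nth_derivative k z t))" for k
  proof (induction k)
    case 0
    show ?case
      by (simp add: nth_derivative_def)
  next
    case (Suc k)
    show ?case
      unfolding nth_derivative_Suc[of k "\<lambda>t. h (z t)"] Suc vector_derivative_at[OF deriv] ..
  qed
  have "(\<lambda>t. h (z t)) \<in> C_infinity"
    by (auto simp: C_infinity_def nth intro: differentiableI_vector deriv)
  moreover have "diff_op n a (\<lambda>t. h (z t)) t = h (diff_op n a z t)" for t
    by (simp add: diff_op_def nth sum scaleR flip: scaleR_conv_of_real)
  ultimately show ?thesis
    using assms(1) by (auto simp: is_solution_def)
qed

lemma quasi_poly_real_rhs: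
  "quasi_poly (of_real \<alpha> + of_real \<beta> * \<i>) \<delta> (complex_poly R) t
     = of_real (poly R t * exp (\<alpha> * t)) * cis (\<beta> * t + \<delta>)"
proof -
  have "(of_real \<alpha> + of_real \<beta> * \<i>) * of_real t + \<i> * of_real \<delta>
      = of_real (\<alpha> * t) + \<i> * of_real (\<beta> * t + \<delta>)"
    by (simp add: algebra_simps)
  then have "exp ((of_real \<alpha> + of_real \<beta> * \<i>) * of_real t + \<i> * of_real \<delta>)
      = of_real (exp (\<alpha> * t)) * cis (\<beta> * t + \<delta>)"
    by (simp only: exp_add exp_of_real cis_conv_exp)
  then show ?thesis
    by (simp add: quasi_poly_def poly_complex_poly_of_real)
qed

section \<open>Solving the differential equation\<close>

theorem theorem3:
  fixes n :: nat and a :: "nat \<Rightarrow> real" and R :: "real poly" and \<gamma> :: complex and \<delta> :: real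
  assumes "\<exists>j\<in>{1..n}. a j \<noteq> 0"
    and "R \<noteq> 0"
    and "\<gamma> \<in> \<real> \<Longrightarrow> \<delta> = 0"
  shows
    "(\<exists>Q. is_solution n a (quasi_poly \<gamma> \<delta> (complex_poly R)) (quasi_poly \<gamma> \<delta> Q))
     \<and> (\<exists>Q. reduced_eq n a \<gamma> R Q)
     \<and> (\<forall>Q. reduced_eq n a \<gamma> R Q \<longrightarrow>
            is_solution n a (quasi_poly \<gamma> \<delta> (complex_poly R)) (quasi_poly \<gamma> \<delta> Q))
     \<and> (\<gamma> \<in> \<real> \<longrightarrow>
          (\<exists>Q :: real poly. reduced_eq n a \<gamma> R (complex_poly Q)
             \<and> is_solution n a (quasi_poly \<gamma> \<delta> (complex_poly R))
                 (\<lambda>t. of_real (poly Q t) * exp (\<gamma> * of_real t))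
             \<and> (\<forall>t::real. of_real (poly Q t) * exp (\<gamma> * of_real t) \<in> \<real>)))
     \<and> (\<gamma> \<notin> \<real> \<longrightarrow>
          (\<forall>Q \<alpha> \<beta> z. reduced_eq n a \<gamma> R Q \<and> \<gamma> = of_real \<alpha> + of_real \<beta> * \<i> \<and> z = quasi_poly \<gamma> \<delta> Q \<longrightarrow>
             is_solution n a (quasi_poly \<gamma> \<delta> (complex_poly R)) z
             \<and> is_solution n a
                 (\<lambda>t. of_real (poly R t * exp (\<alpha> * t) * cos (\<beta> * t + \<delta>))) (\<lambda>t. of_real (Re (z t)))
             \<and> is_solution n a
                 (\<lambda>t. of_real (poly R t * exp (\<alpha> * t) * sin (\<beta> * t + \<delta>))) (\<lambda>t. of_real (Im (z t)))))
     \<and> (poly (complex_poly (characteristic_poly n a)) \<gamma> \<noteq> 0 \<longrightarrow>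
          (\<forall>Q. reduced_eq n a \<gamma> R Q \<longrightarrow> degree Q = degree R))
     \<and> (\<forall>k. poly (complex_poly (characteristic_poly n a)) \<gamma> = 0
            \<and> order \<gamma> (complex_poly (characteristic_poly n a)) = k \<longrightarrow>
          (\<exists>Q\<^sub>1. reduced_eq n a \<gamma> R (monom 1 k * Q\<^sub>1) \<and> degree Q\<^sub>1 = degree R))"
proof (intro conjI impI allI)
  let ?p = "complex_poly (characteristic_poly n a)"
  have nz: "characteristic_poly n a \<noteq> 0"
    using assms(1) by (metis atLeastAtMost_iff coeff_0 coeff_characteristic_poly)
  note ord = taylor_coeff_characteristic_poly_order[OF nz, where \<gamma> = \<gamma>]
  have degR: "degree (complex_poly R) = degree R"
    by (simp add: degree_map_poly)
  obtain Q\<^sub>1 where Q\<^sub>1: "reduced_eq n a \<gamma> R (monom 1 (order \<gamma> ?p) * Q\<^sub>1)" and deg: "degree Q\<^sub>1 = degree R"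
    using const_coeff_op_monom_mult_surj[OF ord, where R = "complex_poly R"]
    unfolding reduced_eq_iff degR by metis
  show "\<exists>Q. reduced_eq n a \<gamma> R Q"
    using Q\<^sub>1 by blast
  show "\<exists>Q. is_solution n a (quasi_poly \<gamma> \<delta> (complex_poly R)) (quasi_poly \<gamma> \<delta> Q)"
    using Q\<^sub>1 is_solution_quasi_poly by blast
  show "is_solution n a (quasi_poly \<gamma> \<delta> (complex_poly R)) (quasi_poly \<gamma> \<delta> Q)"
    if "reduced_eq n a \<gamma> R Q" for Q
    using that by (rule is_solution_quasi_poly)
  show "\<exists>Q\<^sub>1. reduced_eq n a \<gamma> R (monom 1 k * Q\<^sub>1) \<and> degree Q\<^sub>1 = degree R"
    if "poly ?p \<gamma> = 0 \<and> order \<gamma> ?p = k" for k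
    using that Q\<^sub>1 deg by blast
  \<comment> \<open>Here the factor \<open>t\<^sup>m\<close> of the triangular system is trivial, so every \<open>Q\<close> has the
    required form.\<close>
  show "degree Q = degree R" if p: "poly ?p \<gamma> \<noteq> 0" and Q: "reduced_eq n a \<gamma> R Q" for Q
  proof -
    have "order \<gamma> ?p = 0"
      using p by (rule order_0I)
    then show ?thesis
      using degree_const_coeff_op_monom_mult[OF ord, of Q] Q degR
      by (simp add: reduced_eq_iff monom_0)
  qed
  show "\<exists>Q :: real poly. reduced_eq n a \<gamma> R (complex_poly Q)
      \<and> is_solution n a (quasi_poly \<gamma> \<delta> (complex_poly R))
          (\<lambda>t. of_real (poly Q t) * exp (\<gamma> * of_real t))
      \<and> (\<forall>t::real. of_real (poly Q t) * exp (\<gamma> * of_real t) \<in> \<real>)"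
    if real: "\<gamma> \<in> \<real>"
  proof -
    obtain g where g: "\<gamma> = of_real g"
      using real by (rule Reals_cases)
    obtain Q :: "real poly" where Q: "reduced_eq n a \<gamma> R (complex_poly Q)"
      using reduced_eq_real_solution[OF nz] g by blast
    have "quasi_poly \<gamma> \<delta> (complex_poly Q) = (\<lambda>t. of_real (poly Q t) * exp (\<gamma> * of_real t))"
      using assms(3)[OF real] by (simp add: quasi_poly_def poly_complex_poly_of_real)
    then have "is_solution n a (quasi_poly \<gamma> \<delta> (complex_poly R))
        (\<lambda>t. of_real (poly Q t) * exp (\<gamma> * of_real t))"
      using is_solution_quasi_poly[OF Q, of \<delta>] by simp
    moreover have "of_real (poly Q t) * exp (\<gamma> * of_real t) \<in> \<real>" for t :: real
      unfolding g by (intro Reals_mult Reals_of_real) (simp flip: of_real_mult exp_of_real)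
    ultimately show ?thesis
      using Q by blast
  qed
  fix Q \<alpha> \<beta> z
  assume "reduced_eq n a \<gamma> R Q \<and> \<gamma> = of_real \<alpha> + of_real \<beta> * \<i> \<and> z = quasi_poly \<gamma> \<delta> Q"
  then have Q: "reduced_eq n a \<gamma> R Q" and \<gamma>: "\<gamma> = of_real \<alpha> + of_real \<beta> * \<i>"
    and z: "z = quasi_poly \<gamma> \<delta> Q"
    by blast+
  show sol: "is_solution n a (quasi_poly \<gamma> \<delta> (complex_poly R)) z"
    unfolding z using Q by (rule is_solution_quasi_poly)
  have "bounded_linear (\<lambda>w. complex_of_real (Re w))" and "bounded_linear (\<lambda>w. complex_of_real (Im w))"
    by (intro bounded_linear_compose[OF bounded_linear_of_real] bounded_linear_Re bounded_linear_Im)+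
  from this[THEN is_solution_bounded_linear[OF sol]]
  show "is_solution n a (\<lambda>t. of_real (poly R t * exp (\<alpha> * t) * cos (\<beta> * t + \<delta>))) (\<lambda>t. of_real (Re (z t)))"
    and "is_solution n a (\<lambda>t. of_real (poly R t * exp (\<alpha> * t) * sin (\<beta> * t + \<delta>))) (\<lambda>t. of_real (Im (z t)))"
    unfolding \<gamma> quasi_poly_real_rhs by simp_all
qed

end
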